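(* Let $p\ge 2$ be a fixed integer. For integers $n\ge 1$ and $1\le k<n$, $$t(n,k)=\sum_{m=k}^{n}\binom{n}{m}\,\frac{m-k}{n-k}\,(pn-pk)_{(n-m)}\,y(m,k),$$ and for every $n\ge 1$, $$t(n,n)=\prod_{j=0}^{n-1}(pj-j+1).$$ Here $t(n,k)$ is the number of $p$-ary labeled trees on $[n]$ whose maximal decreasing subtree has exactly $k$ vertices, $y(m,k)$ is the number of $p$-ary labeled trees on $[m]$ obtained from a decreasing $p$-ary tree with $k$ vertices by attaching $m-k$ increasing leaves, and $a_{(\ell)}=a(a-1)\cdots(a-\ell+1)$ is the falling factorial.
   Context: Fix an integer $p\ge 2$ and write $[n]=\{1,2,\dots,n\}$. A $p$-ary tree $T$ is defined recursively: either $T$ is empty, or $T$ has a distinguished vertex $r$ (the root) and $T-r$ is split into an ordered $p$-tuple $(T_1,\dots,T_p)$ of (possibly empty) $p$-ary trees. So each vertex has $p$ distinguishable child positions, each of which is empty or occupied by one child. A $p$-ary labeled tree on $[n]$ is a $p$-ary tree with $n$ vertices labeled bijectively by $[n]$. An edge from a parent to a child is decreasing if the child's label is smaller than the parent's label, and increasing otherwise. A decreasing $p$-ary tree is a $p$-ary labeled tree all of whose edges are decreasing. The maximal decreasing subtree $\mathrm{MD}(T)$ of a $p$-ary labeled tree $T$ is the maximal $p$-ary subtree containing the root of $T$ all of whose edges are decreasing. In other words, it consists of the vertices $v$ such that all edges on the path from the root to $v$ are decreasing. $t(n,k)$ is the number of $p$-ary labeled trees $T$ on $[n]$ such that $\mathrm{MD}(T)$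 has exactly $k$ vertices. $y(m,k)$ is the number of $p$-ary labeled trees $T$ on $[m]$ obtained from a decreasing $p$-ary tree with $k$ vertices by attaching $m-k$ additional increasing leaves: each added vertex is a leaf of $T$, occupies a previously empty child position of a vertex of the decreasing tree, and has a label larger than its parent's. Equivalently, $\mathrm{MD}(T)$ has exactly $k$ vertices and every vertex of $T$ outside $\mathrm{MD}(T)$ is a leaf whose parent lies in $\mathrm{MD}(T)$. The falling factorial is $a_{(\ell)}=a(a-1)\cdots(a-\ell+1)$, with $a_{(0)}=1$. *)

theory Defs
  imports Complex_Main
begin

datatype 'a tree = Empty | Node (root: 'a) (subtrees: "'a tree list")

text \<open>An empty child position is an explicit \<open>Empty\<close> in the list of subtrees, so the
  \<open>p\<close> positions of a vertex are distinguishable.\<close>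

fun pary :: "nat \<Rightarrow> 'a tree \<Rightarrow> bool" where
  "pary p Empty \<longleftrightarrow> True"
| "pary p (Node a ts) \<longleftrightarrow> length ts = p \<and> (\<forall>t\<in>set ts. pary p t)"

fun labels :: "'a tree \<Rightarrow> 'a list" where
  "labels Empty = []"
| "labels (Node a ts) = a # concat (map labels ts)"

definition num_vertices :: "'a tree \<Rightarrow> nat" where
  "num_vertices T = length (labels T)"

definition labeled_trees :: "nat \<Rightarrow> nat \<Rightarrow> nat tree set" where
  "labeled_trees p n = {T. pary p T \<and> distinct (labels T) \<and> set (labels T) = {1..n}}"

fun decreasing :: "nat tree \<Rightarrow> bool" where
  "decreasing Empty \<longleftrightarrow> True"
| "decreasing (Node a ts) \<longleftrightarrow> (\<forall>t\<in>set ts. (t \<noteq> Empty \<longrightarrow> root t < a) \<and> decreasing t)"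

text \<open>The maximal decreasing subtree: every subtree hanging below an increasing edge is removed.\<close>

fun MD :: "nat tree \<Rightarrow> nat tree" where
  "MD Empty = Empty"
| "MD (Node a ts) = Node a (map (\<lambda>t. if t \<noteq> Empty \<and> root t < a then MD t else Empty) ts)"

text \<open>\<open>rooted_subtree S T\<close>: \<open>S\<close> arises from \<open>T\<close> by removing some subtrees, and contains the
  root of \<open>T\<close> unless \<open>S\<close> is empty. The lemmas \<open>MD_rooted_subtree\<close>,
  \<open>MD_decreasing\<close> and \<open>MD_greatest\<close> state that \<open>MD T\<close> is the greatest
  decreasing tree with this property.\<close>

inductive rooted_subtree :: "'a tree \<Rightarrow> 'a tree \<Rightarrow> bool" where
  "rooted_subtree Empty T"
| "list_all2 rooted_subtree ss ts \<Longrightarrow> rooted_subtree (Node a ss) (Node a ts)"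

lemma MD_rooted_subtree: "rooted_subtree (MD T) T"
proof (induction T rule: MD.induct)
  case 1
  show ?case by (simp add: rooted_subtree.intros)
next
  case (2 a ts)
  then show ?case
    by (auto intro!: rooted_subtree.intros simp: list_all2_conv_all_nth)
qed

lemma root_MD: "MD T \<noteq> Empty \<Longrightarrow> root (MD T) = root T"
  by (cases T) auto

lemma MD_decreasing: "decreasing (MD T)"
  by (induction T rule: MD.induct) (auto simp: root_MD)

lemma MD_greatest:
  assumes "rooted_subtree S T" "decreasing S"
  shows "rooted_subtree S (MD T)"
  using assms
proof (induction rule: rooted_subtree.induct)
  case (1 T)
  show ?case by (rule rooted_subtree.intros)
next
  case (2 ss ts a)
  have "rooted_subtree (ss ! i) (if ts ! i \<noteq> Empty \<and> root (ts ! i) < a then MD (ts ! i) else Empty)"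
    if i: "i < length ts" for i
  proof (cases "ss ! i")
    case Empty
    then show ?thesis by (simp add: rooted_subtree.intros)
  next
    case (Node b us)
    have len: "length ss = length ts" and st: "rooted_subtree (ss ! i) (ts ! i)"
      and IH: "decreasing (ss ! i) \<Longrightarrow> rooted_subtree (ss ! i) (MD (ts ! i))"
      using 2(1) i by (auto simp: list_all2_conv_all_nth)
    have dec: "decreasing (ss ! i)" and "b < a"
      using 2(2) i len Node nth_mem[of i ss] by auto
    moreover have "ts ! i \<noteq> Empty \<and> root (ts ! i) = b"
      using st unfolding Node by (auto elim: rooted_subtree.cases)
    ultimately show ?thesis using IH by simp
  qed
  moreover have "length ss = length ts"
    using 2(1) by (auto dest: list_all2_lengthD)
  ultimately show ?case
    by (auto intro!: rooted_subtree.intros(2) simp: list_all2_conv_all_nth)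
qed

definition t_count :: "nat \<Rightarrow> nat \<Rightarrow> nat \<Rightarrow> nat" where
  "t_count p n k = card {T \<in> labeled_trees p n. num_vertices (MD T) = k}"

text \<open>\<open>attach_incr_leaves p D T\<close>: \<open>T\<close> arises from \<open>D\<close> by filling some of the empty child
  positions of vertices of \<open>D\<close> with leaves whose label exceeds that of their parent.\<close>

inductive attach_incr_leaves :: "nat \<Rightarrow> nat tree \<Rightarrow> nat tree \<Rightarrow> bool" for p where
  "attach_incr_leaves p Empty Empty"
| "list_all2 (\<lambda>d s. attach_incr_leaves p d s \<or>
      d = Empty \<and> (\<exists>l>a. s = Node l (replicate p Empty))) ds ts
    \<Longrightarrow> attach_incr_leaves p (Node a ds) (Node a ts)"

definition y_count :: "nat \<Rightarrow> nat \<Rightarrow> nat \<Rightarrow> nat" where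
  "y_count p m k = card {T \<in> labeled_trees p m.
     \<exists>D. pary p D \<and> decreasing D \<and> num_vertices D = k \<and> attach_incr_leaves p D T}"

definition falling_factorial :: "'a::comm_ring_1 \<Rightarrow> nat \<Rightarrow> 'a" where
  "falling_factorial a l = (\<Prod>i<l. a - of_nat i)"

end

theory Submission
  imports Defs "HOL-Library.Multiset" "HOL-Library.Infinite_Set"
begin

text \<open>Cut every tree at its increasing edges nearest to the root. Let \<open>T\<close> be a tree on \<open>[n]\<close> whose maximal
  decreasing subtree has \<open>k\<close> vertices. Replacing each increasing child of a vertex of that subtree by
  a leaf yields a skeleton with \<open>m\<close> vertices, that is, a decreasing tree with \<open>k\<close> vertices and
  \<open>m - k\<close> increasing leaves. The rest of \<open>T\<close> is an arbitrary filling of the \<open>p (m - k)\<close> child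
  positions of these leaves by \<open>p\<close>-ary trees on the remaining \<open>n - m\<close> labels. Skeleton and filling
  determine \<open>T\<close>, and every combination with complementary label sets occurs
  (\<open>bij_betw_skeleton_hanging\<close>). There are \<open>n choose m\<close> label sets for the skeleton, and each admits
  \<open>y(m,k)\<close> skeletons by relabelling (\<open>card_skeletons\<close>).

  It remains to count fillings. Let \<open>h(s,N)\<close> be the number of ways to fill \<open>s\<close> positions with possibly
  empty \<open>p\<close>-ary trees using exactly \<open>N\<close> labels. The first position is vacant, or it holds one of the
  \<open>N\<close> labels, whose \<open>p\<close> child positions then replace it; so
  \<open>h(s+1,N) = h(s,N) + N h(s+p,N-1)\<close>. This recurrence has the closed solution of \<open>card_forests\<close>, and for
  \<open>s = p (m - k)\<close>, \<open>N = n - m\<close> it is the coefficient in the theorem (\<open>forest_number_rooted\<close>).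

  For \<open>k = n\<close> the tree is decreasing. Fillings of \<open>s\<close> positions by decreasing trees satisfy
  \<open>d(s,N) = s d(s+p-1,N-1)\<close>, because the largest label is the root of one of the \<open>s\<close> trees
  (\<open>card_decreasing_forests\<close>); starting from \<open>s = 1\<close> this gives the product.\<close>

section \<open>Forests of possibly empty trees\<close>

lemma num_vertices_simps [simp]:
  "num_vertices Empty = 0"
  "num_vertices (Node a ts) = Suc (sum_list (map num_vertices ts))"
  by (simp_all add: num_vertices_def[abs_def] length_concat comp_def)

text \<open>Trees in the list may be \<open>Empty\<close>: a list of length \<open>s\<close> describes how \<open>s\<close> child positions
  are filled, and a tree is the case \<open>s = 1\<close>.\<close>

definition forests :: "nat \<Rightarrow> nat \<Rightarrow> 'a set \<Rightarrow> 'a tree list set" where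
  "forests p s V = {ts. length ts = s \<and> (\<forall>t\<in>set ts. pary p t) \<and>
     distinct (concat (map labels ts)) \<and> set (concat (map labels ts)) = V}"

lemma falling_factorial_Suc:
  "falling_factorial x (Suc l) = falling_factorial x l * (x - of_nat l)"
  by (simp add: falling_factorial_def)

lemma falling_factorial_shift:
  "falling_factorial (x + 1) (Suc l) = (x + 1) * falling_factorial x l"
  by (simp add: falling_factorial_def prod.lessThan_Suc_shift del: prod.lessThan_Suc)

lemma falling_factorial_0 [simp]: "falling_factorial x 0 = 1"
  by (simp add: falling_factorial_def)

text \<open>For \<open>N \<ge> 1\<close> this is \<open>s / (s + p N)\<close> times the falling factorial of \<open>s + p N\<close> of length \<open>N\<close>,
  with the factor \<open>s + p N\<close> cancelled, so that the recurrence needs no division. For \<open>N = 0\<close> all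
  positions are vacant, and this counts as one filling also when \<open>s = 0\<close>, where the quotient is
  undefined.\<close>

definition forest_number :: "nat \<Rightarrow> nat \<Rightarrow> nat \<Rightarrow> real" where
  "forest_number p s N =
     (if N = 0 then 1 else real s * falling_factorial (real s + real p * real N - 1) (N - 1))"

text \<open>For \<open>N \<ge> 2\<close>, after a common falling factorial is taken out, with \<open>x = s + p N - 1\<close>, the identity becomes
  \<open>(s + 1) (x + 1) = s (x - N + 2) + N (s + p)\<close>, which holds because \<open>x + 1 = s + p N\<close>.\<close>

lemma forest_number_rec:
  assumes "N > 0"
  shows "forest_number p (Suc s) N = forest_number p s N + real N * forest_number p (p + s) (N - 1)"
proof (cases "N = 1")
  case False
  then obtain M where N: "N = Suc (Suc M)"
    using assms by (cases N; cases "N - 1") auto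
  define x where "x = real s + real p * real N - 1"
  have 1: "forest_number p (Suc s) N = (real s + 1) * ((x + 1) * falling_factorial x M)"
  proof -
    have "real (Suc s) + real p * real N - 1 = x + 1" by (simp add: x_def)
    then show ?thesis using falling_factorial_shift[of x M] by (simp add: forest_number_def N)
  qed
  have 2: "forest_number p s N = real s * (falling_factorial x M * (x - real M))"
    using falling_factorial_Suc[of x M] by (simp add: forest_number_def N x_def)
  have "real (p + s) + real p * real (N - 1) - 1 = x"
    by (simp add: N x_def distrib_left)
  then have 3: "forest_number p (p + s) (N - 1) = (real p + real s) * falling_factorial x M"
    by (simp add: forest_number_def N)
  have "(real s + 1) * (x + 1) = real s * (x - real M) + real N * (real p + real s)"
    by (simp add: x_def N algebra_simps)
  then have "(real s + 1) * (x + 1) * falling_factorial x M =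
      (real s * (x - real M) + real N * (real p + real s)) * falling_factorial x M" by simp
  then show ?thesis unfolding 1 2 3 by (simp add: ring_distribs mult_ac)
qed (simp add: forest_number_def)

lemma root_in_labels: "t \<noteq> Empty \<Longrightarrow> root t \<in> set (labels t)"
  by (cases t) auto

lemma labels_subset_forests: "ts \<in> forests p s V \<Longrightarrow> t \<in> set ts \<Longrightarrow> set (labels t) \<subseteq> V"
  unfolding forests_def by auto

lemma forests_0: "forests p 0 V = (if V = {} then {[]} else {})"
  by (auto simp: forests_def)

text \<open>The first position is either vacant, or filled by a vertex whose \<open>p\<close> child positions are put in
  front of the remaining positions. Removing a vertex thus trades one position for \<open>p\<close>.\<close>

lemma forests_Suc:
  "forests p (Suc s) V = (#) Empty ` forests p s V \<union>
     (\<Union>a\<in>V. (\<lambda>us. Node a (take p us) # drop p us) ` forests p (p + s) (V - {a}))"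
  (is "?L = ?A \<union> ?B")
proof (intro equalityI subsetI)
  fix ts assume "ts \<in> ?L"
  then obtain t rs where ts: "ts = t # rs" and *: "length rs = s" "pary p t" "\<forall>t\<in>set rs. pary p t"
     "distinct (concat (map labels (t # rs)))" "set (concat (map labels (t # rs))) = V"
    by (auto simp: forests_def length_Suc_conv)
  show "ts \<in> ?A \<union> ?B"
  proof (cases t)
    case Empty
    then show ?thesis using * ts by (auto simp: forests_def)
  next
    case (Node a us)
    have "us @ rs \<in> forests p (p + s) (V - {a})" "a \<in> V"
      using * Node by (auto simp: forests_def)
    moreover have "ts = Node a (take p (us @ rs)) # drop p (us @ rs)"
      using * Node ts by simp
    ultimately show ?thesis by blast
  qed
next
  fix ts assume "ts \<in> ?A \<union> ?B"
  then show "ts \<in> ?L"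
  proof
    assume "ts \<in> ?A" then show ?thesis by (auto simp: forests_def)
  next
    assume "ts \<in> ?B"
    then obtain a us where a: "a \<in> V" and us: "us \<in> forests p (p + s) (V - {a})"
      and ts: "ts = Node a (take p us) # drop p us" by blast
    define xs ys where "xs = take p us" and "ys = drop p us"
    have "us = xs @ ys" "length xs = p" "length ys = s"
      using us by (auto simp: xs_def ys_def forests_def)
    then show ?thesis using a us unfolding ts xs_def[symmetric] ys_def[symmetric]
      by (auto simp: forests_def)
  qed
qed

lemma card_forests:
  assumes "finite V"
  shows "finite (forests p s V) \<and> real (card (forests p s V)) = forest_number p s (card V)"
  using assms
proof (induction "card V" arbitrary: V s rule: less_induct)
  case less
  note outer = less.hyps
  have fin: "finite V" by fact
  show ?case
  proof (induction s)
    case 0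
    then show ?case using fin by (auto simp: forests_0 forest_number_def)
  next
    case (Suc s)
    let ?f = "\<lambda>a us. Node a (take p us) # drop p us"
    let ?B = "\<lambda>a. ?f a ` forests p (p + s) (V - {a})"
    have inj: "inj_on (?f a) X" for a :: 'a and X
    proof (rule inj_onI)
      fix us vs assume "?f a us = ?f a vs"
      then have "take p us = take p vs" "drop p us = drop p vs" by simp_all
      then show "us = vs" by (metis append_take_drop_id)
    qed
    have B: "finite (?B a)" "real (card (?B a)) = forest_number p (p + s) (card V - 1)"
      if "a \<in> V" for a
    proof -
      have "card (V - {a}) < card V" "card (V - {a}) = card V - 1"
        using card_Diff1_less[OF fin that] card_Diff_singleton[OF that] by simp_all
      then show "finite (?B a)" "real (card (?B a)) = forest_number p (p + s) (card V - 1)"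
        using outer[of "V - {a}" "p + s"] fin unfolding card_image[OF inj] by simp_all
    qed
    have "card (\<Union>a\<in>V. ?B a) = (\<Sum>a\<in>V. card (?B a))"
    proof (rule card_UN_disjoint)
      show "\<forall>a\<in>V. \<forall>b\<in>V. a \<noteq> b \<longrightarrow> ?B a \<inter> ?B b = {}" by blast
    qed (use fin B in blast)+
    then have UB: "real (card (\<Union>a\<in>V. ?B a)) = real (card V) * forest_number p (p + s) (card V - 1)"
      using B(2) by simp
    have IH: "finite (forests p s V)" "real (card (forests p s V)) = forest_number p s (card V)"
      using Suc by blast+
    have finB: "finite (\<Union>a\<in>V. ?B a)" using fin B(1) by blast
    have "card (forests p (Suc s) V) = card ((#) Empty ` forests p s V) + card (\<Union>a\<in>V. ?B a)"
      unfolding forests_Suc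
    proof (rule card_Un_disjoint)
      show "(#) Empty ` forests p s V \<inter> (\<Union>a\<in>V. ?B a) = {}" by blast
    qed (use IH finB in blast)+
    then have "real (card (forests p (Suc s) V)) =
        forest_number p s (card V) + real (card V) * forest_number p (p + s) (card V - 1)"
      using IH(2) UB by (simp add: card_image)
    also have "\<dots> = forest_number p (Suc s) (card V)"
      using forest_number_rec[of "card V" p s] by (cases "card V = 0") (auto simp: forest_number_def)
    finally have "real (card (forests p (Suc s) V)) = forest_number p (Suc s) (card V)" .
    moreover have "finite (forests p (Suc s) V)"
      unfolding forests_Suc using IH(1) finB by blast
    ultimately show ?case by (rule conjI[rotated])
  qed
qed


text \<open>Counting forests on \<open>n - k\<close> labels with \<open>m - k\<close> prescribed roots amounts to filling the
  \<open>p (m - k)\<close> child positions of these roots with the other \<open>n - m\<close> labels. The coefficient of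
  \<open>y(m,k)\<close> in the theorem is therefore a forest number.\<close>

lemma forest_number_rooted:
  assumes "k \<le> m" "m \<le> n" "k < n" "p > 0"
  shows "forest_number p (p * (m - k)) (n - m) = (real m - real k) / (real n - real k)
           * falling_factorial (real p * real n - real p * real k) (n - m)"
proof (cases "n = m")
  case False
  then obtain l where l: "n = Suc (m + l)" using assms using less_imp_Suc_add[of m n] by auto
  define x where "x = real p * real n - real p * real k - 1"
  have "forest_number p (p * (m - k)) (n - m) = real p * (real m - real k) * falling_factorial x l"
    using assms by (simp add: forest_number_def l x_def of_nat_diff algebra_simps)
  moreover have "falling_factorial (x + 1) (n - m) = (x + 1) * falling_factorial x l"
    by (simp add: l falling_factorial_shift Suc_diff_le)
  moreover have "x + 1 = real p * (real n - real k)" by (simp add: x_def algebra_simps)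
  moreover have "real n - real k \<noteq> 0" using assms by simp
  ultimately show ?thesis by (simp add: x_def)
qed (use assms in \<open>simp add: forest_number_def\<close>)

section \<open>Decreasing forests\<close>

lemma labels_le_root:
  "decreasing T \<Longrightarrow> x \<in> set (labels T) \<Longrightarrow> x \<le> root T"
proof (induction T)
  case (Node a ts)
  then obtain t where t: "x = a \<or> t \<in> set ts \<and> x \<in> set (labels t)" by auto
  show ?case
  proof (cases "x = a")
    case False
    then have "t \<in> set ts" "x \<in> set (labels t)" using t by auto
    moreover from this have "t \<noteq> Empty" by auto
    ultimately show ?thesis using Node by fastforce
  qed simp
qed simp

definition decreasing_forests :: "nat \<Rightarrow> nat \<Rightarrow> nat set \<Rightarrow> nat tree list set" where
  "decreasing_forests p s V = {ts \<in> forests p s V. \<forall>t\<in>set ts. decreasing t}"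

lemma decreasing_forests_empty: "decreasing_forests p s {} = {replicate s Empty}"
proof -
  have "labels t = [] \<longleftrightarrow> t = Empty" for t :: "nat tree" by (cases t) auto
  then have "set (concat (map labels ts)) = {} \<longleftrightarrow> (\<forall>t\<in>set ts. t = Empty)" for ts :: "nat tree list"
    by simp
  moreover have "length ts = s \<and> (\<forall>t\<in>set ts. t = Empty) \<longleftrightarrow> ts = replicate s Empty"
    for ts :: "nat tree list"
    by (auto intro: replicate_eqI)
  moreover have "distinct (concat (map labels (replicate s Empty)))"
    by (simp add: map_replicate_const concat_replicate_trivial)
  ultimately show ?thesis
    unfolding decreasing_forests_def forests_def by (fastforce simp del: set_concat)
qed

text \<open>The maximal label of a decreasing forest is the root of one of its \<open>s\<close> trees. Replacing that
  tree, in place, by its \<open>p\<close> subtrees loses only the information in which of the \<open>s\<close> places it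
  stood; here \<open>us\<close> is the resulting list and \<open>i\<close> the place.\<close>

lemma card_decreasing_forests_rec:
  assumes "finite V" "V \<noteq> {}" "p > 0"
  shows "card (decreasing_forests p s V) =
    s * card (decreasing_forests p (s + p - 1) (V - {Max V}))"
proof -
  let ?a = "Max V"
  let ?D = "decreasing_forests p (s + p - 1) (V - {?a})"
  let ?f = "\<lambda>(i, us). take i us @ Node ?a (take p (drop i us)) # drop (i + p) us"
  have a: "?a \<in> V" using assms by simp
  have "bij_betw ?f ({..<s} \<times> ?D) (decreasing_forests p s V)"
  proof (rule bij_betw_imageI)
    have no_root: "us ! j \<noteq> Node ?a cs" if "us \<in> ?D" "j < s + p - 1" for us j cs
    proof
      assume "us ! j = Node ?a cs"
      moreover have "us ! j \<in> set us"
        using that by (intro nth_mem) (simp add: decreasing_forests_def forests_def)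
      ultimately have "?a \<in> set (concat (map labels us))" by force
      then show False using that by (auto simp: decreasing_forests_def forests_def)
    qed
    \<comment> \<open>The place is determined by the image, being the position of the tree with root \<open>Max V\<close>.\<close>
    have not_less: "\<not> i < j"
      if "?f (i, us) = ?f (j, vs)" "i < s" "j < s" "us \<in> ?D" "vs \<in> ?D" for i j us vs
    proof
      assume "i < j"
      have len: "length us = s + p - 1" "length vs = s + p - 1"
        using that by (auto simp: decreasing_forests_def forests_def)
      have "(take i us @ Node ?a (take p (drop i us)) # drop (i + p) us) ! i
          = Node ?a (take p (drop i us))"
        using \<open>i < s\<close> len by (simp add: nth_append)
      moreover have "(take j vs @ Node ?a (take p (drop j vs)) # drop (j + p) vs) ! i = vs ! i"
        using \<open>j < s\<close> len \<open>i < j\<close> by (simp add: nth_append)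
      ultimately have "vs ! i = Node ?a (take p (drop i us))"
        using that(1) by simp
      moreover have "i < s + p - 1" using \<open>j < s\<close> \<open>i < j\<close> by simp
      ultimately show False using no_root that(5) by blast
    qed
    have split3: "us = take i us @ take p (drop i us) @ drop (i + p) us" for i and us :: "nat tree list"
      by (metis add.commute append_take_drop_id drop_drop)
    show "inj_on ?f ({..<s} \<times> ?D)"
    proof (rule inj_onI)
      fix x y assume xy: "x \<in> {..<s} \<times> ?D" "y \<in> {..<s} \<times> ?D" and f: "?f x = ?f y"
      obtain i us j vs where pairs: "x = (i, us)" "y = (j, vs)" by (cases x; cases y)
      have *: "i < s" "j < s" "us \<in> ?D" "vs \<in> ?D" using xy pairs by auto
      have "\<not> i < j" by (rule not_less[OF f[unfolded pairs]]) (fact *)+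
      moreover have "\<not> j < i" by (rule not_less[OF f[unfolded pairs, symmetric]]) (fact *)+
      ultimately have ij: "i = j" by simp
      have "length (take i us) = length (take j vs)"
        using * ij by (simp add: decreasing_forests_def forests_def)
      then have "take i us @ take p (drop i us) @ drop (i + p) us =
          take j vs @ take p (drop j vs) @ drop (j + p) vs"
        using f unfolding pairs by (simp add: ij)
      then have "us = vs" unfolding split3[symmetric] .
      then show "x = y" using ij pairs by simp
    qed
    show "?f ` ({..<s} \<times> ?D) = decreasing_forests p s V"
    proof (intro equalityI subsetI)
      fix ts assume "ts \<in> ?f ` ({..<s} \<times> ?D)"
      then obtain i us where i: "i < s" and us: "us \<in> ?D" and ts: "ts = ?f (i, us)" by blast
      define xs ys zs where "xs = take i us" and "ys = take p (drop i us)" and "zs = drop (i + p) us"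
      have "us = xs @ ys @ zs" unfolding xs_def ys_def zs_def by (rule split3)
      moreover have "length xs = i" "length ys = p" "length zs = s - 1 - i"
        using us i by (auto simp: xs_def ys_def zs_def decreasing_forests_def forests_def)
      moreover have "root t < ?a" if "t \<in> set us" "t \<noteq> Empty" for t
      proof -
        have "root t \<in> V - {?a}"
          using that us root_in_labels[of t] labels_subset_forests[of us p "s + p - 1" "V - {?a}" t]
          unfolding decreasing_forests_def by blast
        then show ?thesis using assms(1) by (simp add: order.strict_iff_order)
      qed
      moreover have "ts = xs @ Node ?a ys # zs" by (simp add: ts xs_def ys_def zs_def)
      ultimately show "ts \<in> decreasing_forests p s V" using us i a
        by (auto simp: decreasing_forests_def forests_def)
    next
      fix ts assume ts: "ts \<in> decreasing_forests p s V"
      then have "?a \<in> set (concat (map labels ts))"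
        using a by (simp add: decreasing_forests_def forests_def)
      then obtain t where t: "t \<in> set ts" "?a \<in> set (labels t)" by auto
      from t(2) obtain b cs where tb: "t = Node b cs" by (cases t rule: tree.exhaust) auto
      have "b \<in> V"
        using labels_subset_forests[of ts p s V t] t(1) ts by (simp add: tb decreasing_forests_def)
      then have "b \<le> ?a" using assms(1) by simp
      moreover have "?a \<le> b"
        using labels_le_root[OF _ t(2)] t(1) ts tb unfolding decreasing_forests_def by auto
      ultimately have "b = ?a" by simp
      then obtain xs zs where split: "ts = xs @ Node ?a cs # zs"
        using t(1) tb split_list by metis
      have "length cs = p" "length xs < s"
        using ts split by (auto simp: decreasing_forests_def forests_def)
      moreover have "xs @ cs @ zs \<in> ?D"
        using ts split by (auto simp: decreasing_forests_def forests_def)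
      ultimately show "ts \<in> ?f ` ({..<s} \<times> ?D)"
        using split by (intro image_eqI[of _ _ "(length xs, xs @ cs @ zs)"]) auto
    qed
  qed
  then have "card ({..<s} \<times> ?D) = card (decreasing_forests p s V)"
    by (rule bij_betw_same_card)
  then show ?thesis by (simp add: card_cartesian_product)
qed

lemma card_decreasing_forests:
  assumes "finite V" "p > 0"
  shows "card (decreasing_forests p s V) = (\<Prod>j<card V. s + j * (p - 1))"
  using assms
proof (induction "card V" arbitrary: V s)
  case 0
  then show ?case by (simp add: decreasing_forests_empty)
next
  case (Suc n)
  have "V \<noteq> {}" using Suc by auto
  then have n: "card (V - {Max V}) = n" using Suc(2) card_Diff_singleton[of "Max V" V] Suc(3) by simp
  have "s + p - 1 + j * (p - 1) = s + Suc j * (p - 1)" for j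
    using Suc by simp
  then have "card (decreasing_forests p s V) = s * (\<Prod>j<n. s + Suc j * (p - 1))"
    using Suc(1)[of "V - {Max V}" "s + p - 1"] n Suc(3,4) card_decreasing_forests_rec[of V p s] \<open>V \<noteq> {}\<close>
    by simp
  then show ?case
    unfolding Suc(2)[symmetric] prod.lessThan_Suc_shift by simp
qed

section \<open>Skeletons and hanging forests\<close>

fun stub :: "nat \<Rightarrow> 'a tree \<Rightarrow> 'a tree" where
  "stub p Empty = Empty"
| "stub p (Node a ts) = Node a (replicate p Empty)"

fun children :: "'a tree \<Rightarrow> 'a tree list" where
  "children Empty = []"
| "children (Node a ts) = ts"

text \<open>The skeleton keeps the maximal decreasing subtree and cuts each increasing child down to a leaf.
  The trees counted by \<open>y_count\<close> are those that are their own skeleton. What is cut away is the list of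
  child positions of these leaves, including vacant ones, in the order of a traversal.\<close>

fun skeleton :: "nat \<Rightarrow> nat tree \<Rightarrow> nat tree" where
  "skeleton p Empty = Empty"
| "skeleton p (Node a ts) =
     Node a (map (\<lambda>t. if t \<noteq> Empty \<and> root t < a then skeleton p t else stub p t) ts)"

fun hanging :: "nat tree \<Rightarrow> nat tree list" where
  "hanging Empty = []"
| "hanging (Node a ts) =
     concat (map (\<lambda>t. if t \<noteq> Empty \<and> root t < a then hanging t else children t) ts)"

lemma stub_eq_Empty [simp]: "stub p t = Empty \<longleftrightarrow> t = Empty"
  by (cases t) auto

lemma skeleton_eq_Empty [simp]: "skeleton p t = Empty \<longleftrightarrow> t = Empty"
  by (cases t) auto

lemma root_stub [simp]: "t \<noteq> Empty \<Longrightarrow> root (stub p t) = root t"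
  by (cases t) auto

lemma root_skeleton [simp]: "t \<noteq> Empty \<Longrightarrow> root (skeleton p t) = root t"
  by (cases t) auto

lemma stub_stub [simp]: "stub p (stub p t) = stub p t"
  by (cases t) auto

lemma pary_stub [simp]: "pary p (stub p t)"
  by (cases t) auto

lemma pary_children: "pary p t \<Longrightarrow> u \<in> set (children t) \<Longrightarrow> pary p u"
  by (cases t) auto

lemma skeleton_skeleton: "skeleton p (skeleton p T) = skeleton p T"
  by (induction T) auto

lemma MD_skeleton: "MD (skeleton p T) = MD T"
  by (induction T) auto

lemma pary_skeleton: "pary p T \<Longrightarrow> pary p (skeleton p T)"
  by (induction T) auto

lemma pary_hanging: "pary p T \<Longrightarrow> t \<in> set (hanging T) \<Longrightarrow> pary p t"
proof (induction T)
  case (Node a ts)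
  then show ?case by (fastforce split: if_splits dest: pary_children)
qed simp

lemma mset_labels_stub:
  "mset (labels t) = mset (labels (stub p t)) + mset (concat (map labels (children t)))"
  by (cases t) (simp_all add: map_replicate_const concat_replicate_trivial)

lemma mset_labels_skeleton:
  "mset (labels T) = mset (labels (skeleton p T)) + mset (concat (map labels (hanging T)))"
proof (induction T)
  case (Node a ts)
  let ?c = "\<lambda>t. t \<noteq> Empty \<and> root t < a"
  have "mset (concat (map labels us)) =
      mset (concat (map labels (map (\<lambda>t. if ?c t then skeleton p t else stub p t) us))) +
      mset (concat (map labels (concat (map (\<lambda>t. if ?c t then hanging t else children t) us))))"
    if "set us \<subseteq> set ts" for us
    using that
  proof (induction us)
    case (Cons u us)
    have "mset (labels u) = mset (labels (if ?c u then skeleton p u else stub p u)) +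
        mset (concat (map labels (if ?c u then hanging u else children u)))"
      using Node.IH[of u] Cons.prems mset_labels_stub[of u p] by simp
    then show ?case using Cons by simp
  qed simp
  then show ?case by simp
qed simp

lemma num_vertices_stub: "pary p t \<Longrightarrow> length (children t) = p * num_vertices (stub p t)"
  by (cases t) (auto simp: sum_list_replicate)

text \<open>Every skeleton vertex outside the maximal decreasing subtree contributes \<open>p\<close> positions.\<close>

lemma length_hanging:
  "pary p T \<Longrightarrow> length (hanging T) + p * num_vertices (MD T) = p * num_vertices (skeleton p T)"
proof (induction T)
  case (Node a ts)
  let ?c = "\<lambda>t. t \<noteq> Empty \<and> root t < a"
  have "length (concat (map (\<lambda>t. if ?c t then hanging t else children t) us)) +
      p * sum_list (map num_vertices (map (\<lambda>t. if ?c t then MD t else Empty) us)) =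
      p * sum_list (map num_vertices (map (\<lambda>t. if ?c t then skeleton p t else stub p t) us))"
    if "set us \<subseteq> set ts" for us
    using that
  proof (induction us)
    case (Cons u us)
    have "length (if ?c u then hanging u else children u) +
        p * num_vertices (if ?c u then MD u else Empty) =
        p * num_vertices (if ?c u then skeleton p u else stub p u)"
      using Node Cons.prems num_vertices_stub[of p u] by simp
    moreover have "length (concat (map (\<lambda>t. if ?c t then hanging t else children t) us)) +
      p * sum_list (map num_vertices (map (\<lambda>t. if ?c t then MD t else Empty) us)) =
      p * sum_list (map num_vertices (map (\<lambda>t. if ?c t then skeleton p t else stub p t) us))"
      using Cons by simp
    ultimately show ?case
      by (simp only: list.map concat.simps length_append sum_list.Cons distrib_left add_ac)
  qed simp
  from this[OF subset_refl] show ?case by simp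
qed simp

text \<open>Hence the skeleton alone determines how the list of hanging trees is divided among its branches,
  which is what makes both the uniqueness and the existence of a reassembly provable by structural
  induction.\<close>

lemma length_hanging_skeleton: "pary p T \<Longrightarrow> length (hanging (skeleton p T)) = length (hanging T)"
  using length_hanging[of p T] length_hanging[of p "skeleton p T"]
  by (simp add: pary_skeleton MD_skeleton skeleton_skeleton)

lemma stub_children_inject: "stub p t = stub p u \<Longrightarrow> children t = children u \<Longrightarrow> t = u"
  by (cases t; cases u) auto

lemma skeleton_hanging_inject:
  assumes "pary p T" "pary p U" "skeleton p T = skeleton p U" "hanging T = hanging U"
  shows "T = U"
  using assms
proof (induction T arbitrary: U)
  case Empty
  then show ?case by (cases U) auto
next
  case (Node a ts)
  from Node.prems(3) obtain us where U: "U = Node a us" by (cases U rule: tree.exhaust) auto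
  let ?c = "\<lambda>t. t \<noteq> Empty \<and> root t < a"
  let ?sk = "\<lambda>t. if ?c t then skeleton p t else stub p t"
  let ?ha = "\<lambda>t. if ?c t then hanging t else children t"
  have par: "\<forall>t\<in>set ts. pary p t" "\<forall>u\<in>set us. pary p u" and len: "length ts = length us"
    using Node.prems U by auto
  have sk: "?sk (ts ! i) = ?sk (us ! i)" if "i < length ts" for i
  proof -
    have "map ?sk ts = map ?sk us"
      using Node.prems(3) unfolding U skeleton.simps tree.inject by (rule conjunct2)
    then have "map ?sk ts ! i = map ?sk us ! i" by (rule arg_cong)
    then show ?thesis using that len by (simp only: nth_map)
  qed
  have c: "?c (ts ! i) \<longleftrightarrow> ?c (us ! i)" if "i < length ts" for i
  proof -
    have empty: "?sk t = Empty \<longleftrightarrow> t = Empty" for t by simp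
    have roots: "root (?sk t) = root t" if "t \<noteq> Empty" for t using that by simp
    have e: "ts ! i = Empty \<longleftrightarrow> us ! i = Empty"
      using empty[of "ts ! i"] empty[of "us ! i"] unfolding sk[OF that] by blast
    moreover have "root (ts ! i) = root (us ! i)" if "ts ! i \<noteq> Empty"
      using roots[of "ts ! i"] roots[of "us ! i"] that e unfolding sk[OF \<open>i < length ts\<close>] by argo
    ultimately show ?thesis by auto
  qed
  \<comment> \<open>The number of positions contributed by a child depends only on its cut-down version.\<close>
  have slots: "length (?ha t) = length (if ?c t then hanging (?sk t) else children (?sk t))"
    if "pary p t" for t
  proof (cases t)
    case (Node b vs)
    then show ?thesis using that length_hanging_skeleton[OF that] by auto
  qed simp
  have lens: "length (?ha (ts ! i)) = length (?ha (us ! i))" if "i < length ts" for i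
  proof -
    have "pary p (ts ! i)" "pary p (us ! i)" using par len that by simp_all
    note slots[OF this(1)]
    also have "length (if ?c (ts ! i) then hanging (?sk (ts ! i)) else children (?sk (ts ! i))) =
        length (if ?c (us ! i) then hanging (?sk (us ! i)) else children (?sk (us ! i)))"
      by (unfold sk[OF that], unfold c[OF that], rule refl)
    also note slots[OF \<open>pary p (us ! i)\<close>, symmetric]
    finally show ?thesis .
  qed
  have "concat (map ?ha ts) = concat (map ?ha us)"
    using Node.prems(4) U by (simp only: hanging.simps)
  moreover have "\<forall>(x, y)\<in>set (zip (map ?ha ts) (map ?ha us)). length x = length y"
  proof (clarsimp simp only: set_zip length_map)
    fix i assume "i < min (length ts) (length us)"
    then show "length (map ?ha ts ! i) = length (map ?ha us ! i)"
      using lens[of i] by (simp only: nth_map min_less_iff_conj)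
  qed
  ultimately have "map ?ha ts = map ?ha us"
    using concat_eq_concat_iff[of "map ?ha ts" "map ?ha us"] len by (simp only: length_map)
  then have ha: "?ha (ts ! i) = ?ha (us ! i)" if "i < length ts" for i
      proof -
    have "map ?ha ts ! i = map ?ha us ! i" by (rule arg_cong) fact
    then show ?thesis using that len by (simp only: nth_map)
  qed
  have "ts ! i = us ! i" if i: "i < length ts" for i
  proof (cases "?c (ts ! i)")
    case True
    then have c': "?c (us ! i)" using c[OF i] by blast
    have "skeleton p (ts ! i) = skeleton p (us ! i)" "hanging (ts ! i) = hanging (us ! i)"
      using sk[OF i] ha[OF i] unfolding if_P[OF True] if_P[OF c'] by blast+
    then show ?thesis using Node.IH[of "ts ! i" "us ! i"] par i len by simp
  next
    case False
    then have c': "\<not> ?c (us ! i)" using c[OF i] by blast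
    show ?thesis
      using sk[OF i] ha[OF i] unfolding if_not_P[OF False] if_not_P[OF c']
      by (rule stub_children_inject)
  qed
  then show ?case using U len by (auto intro: nth_equalityI)
qed

lemma split_list_by_lengths:
  "length xs = sum_list ns \<Longrightarrow> \<exists>xss. concat xss = xs \<and> map length xss = ns"
proof (induction ns arbitrary: xs)
  case (Cons n ns)
  obtain xss where "concat xss = drop n xs" "map length xss = ns"
    using Cons.IH[of "drop n xs"] Cons.prems by auto
  then show ?case using Cons.prems by (intro exI[of _ "take n xs # xss"]) simp
qed simp

text \<open>A skeleton is its own skeleton, with only vacant positions hanging from it, so
  \<open>length (hanging S)\<close> is the number of positions to be filled.\<close>

lemma ex_skeleton_hanging:
  assumes "pary p S" "skeleton p S = S" "length us = length (hanging S)" "\<forall>u\<in>set us. pary p u"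
  shows "\<exists>T. pary p T \<and> skeleton p T = S \<and> hanging T = us"
  using assms
proof (induction S arbitrary: us)
  case (Node a ss)
  let ?c = "\<lambda>t. t \<noteq> Empty \<and> root t < a"
  let ?sk = "\<lambda>t. if ?c t then skeleton p t else stub p t"
  let ?ha = "\<lambda>t. if ?c t then hanging t else children t"
  have len: "length ss = p" and par: "\<forall>s\<in>set ss. pary p s" using Node.prems by auto
  have sk: "?sk s = s" if "s \<in> set ss" for s
  proof -
    have "map ?sk ss = map (\<lambda>s. s) ss" using Node.prems(2) by simp
    then show ?thesis using that unfolding map_eq_conv by blast
  qed
  have "length us = sum_list (map length (map ?ha ss))"
    using Node.prems(3) by (simp only: hanging.simps length_concat)
  then obtain uss where uss: "concat uss = us" "map length uss = map length (map ?ha ss)"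
    using split_list_by_lengths[of us] by blast
  then have lenu: "length uss = length ss" using map_eq_imp_length_eq[OF uss(2)] by simp
  have "\<exists>t. pary p t \<and> ?sk t = ss ! i \<and> ?ha t = uss ! i" if i: "i < length ss" for i
  proof -
    let ?s = "ss ! i"
    have l: "length (uss ! i) = length (?ha ?s)"
    proof -
      have "map length uss ! i = map length (map ?ha ss) ! i" by (simp only: uss(2))
      then show ?thesis using i lenu by (simp only: nth_map length_map)
    qed
    have pu: "\<forall>u\<in>set (uss ! i). pary p u"
      using Node.prems(4) uss(1) i lenu by auto
    have s: "?s \<in> set ss" using i by simp
    show ?thesis
    proof (cases "?c ?s")
      case True
      then have "skeleton p ?s = ?s" using sk[OF s] by simp
      moreover have "length (uss ! i) = length (hanging ?s)" using l unfolding if_P[OF True] .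
      ultimately obtain t where t: "pary p t" "skeleton p t = ?s" "hanging t = uss ! i"
        using Node.IH[OF s, of "uss ! i"] par s pu by blast
      from t(2) True have "t \<noteq> Empty" by auto
      then have "?c t" using True root_skeleton[of t p] unfolding t(2) by simp
      then show ?thesis using t by (intro exI[of _ t]) simp
    next
      case False
      then have st: "stub p ?s = ?s" using sk[OF s] by (simp only: if_False)
      show ?thesis
      proof (cases ?s)
        case Empty
        then show ?thesis using l by (intro exI[of _ Empty]) simp
      next
        case (Node b vs)
        then show ?thesis using l st False pu by (intro exI[of _ "Node b (uss ! i)"]) auto
      qed
    qed
  qed
  then obtain ts where ts: "length ts = length ss"
      "\<forall>i<length ss. pary p (ts ! i) \<and> ?sk (ts ! i) = ss ! i \<and> ?ha (ts ! i) = uss ! i"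
    using Skolem_list_nth[of "length ss" "\<lambda>i t. pary p t \<and> ?sk t = ss ! i \<and> ?ha t = uss ! i"] by blast
  have "map ?sk ts = ss" "map ?ha ts = uss"
  proof -
    have nth: "?sk (ts ! i) = ss ! i" "?ha (ts ! i) = uss ! i" if "i < length ss" for i
      using ts(2) that by blast+
    show "map ?sk ts = ss"
      by (rule nth_equalityI) (simp_all only: length_map ts(1) nth_map nth)
    show "map ?ha ts = uss"
      by (rule nth_equalityI) (simp_all only: length_map ts(1) nth_map nth lenu)
  qed
  then have "skeleton p (Node a ts) = Node a ss" "hanging (Node a ts) = us"
    using uss(1) by (simp_all only: skeleton.simps hanging.simps)
  moreover have "pary p (Node a ts)" using ts len by (auto simp: in_set_conv_nth)
  ultimately show ?case by blast
qed simp

section \<open>Skeletons as decreasing trees with increasing leaves\<close>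

lemma attach_incr_leaves_root:
  "attach_incr_leaves p D T \<Longrightarrow> (D = Empty \<longleftrightarrow> T = Empty) \<and> (D \<noteq> Empty \<longrightarrow> root D = root T)"
  by (auto elim: attach_incr_leaves.cases)

text \<open>The decreasing tree from which a tree arises by attaching increasing leaves can only be the
  maximal decreasing subtree, because an attached leaf is larger than its parent.\<close>

lemma attach_incr_leaves_imp:
  assumes "attach_incr_leaves p D T" "decreasing D"
  shows "MD T = D \<and> skeleton p T = T"
  using assms
proof (induction rule: attach_incr_leaves.induct)
  case (2 a ds ts)
  let ?c = "\<lambda>t. t \<noteq> Empty \<and> root t < a"
  have len: "length ds = length ts" using 2(1) by (rule list_all2_lengthD)
  have *: "(if ?c (ts ! i) then MD (ts ! i) else Empty) = ds ! i \<and>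
      (if ?c (ts ! i) then skeleton p (ts ! i) else stub p (ts ! i)) = ts ! i"
    if i: "i < length ts" for i
  proof -
    have d: "ds ! i \<in> set ds" using i len by simp
    have "attach_incr_leaves p (ds ! i) (ts ! i) \<and>
          (decreasing (ds ! i) \<longrightarrow> MD (ts ! i) = ds ! i \<and> skeleton p (ts ! i) = ts ! i) \<or>
        ds ! i = Empty \<and> (\<exists>l>a. ts ! i = Node l (replicate p Empty))"
      using list_all2_nthD2[OF 2(1) i] by blast
    then show ?thesis
    proof
      assume A: "attach_incr_leaves p (ds ! i) (ts ! i) \<and>
          (decreasing (ds ! i) \<longrightarrow> MD (ts ! i) = ds ! i \<and> skeleton p (ts ! i) = ts ! i)"
      show ?thesis
      proof (cases "ds ! i = Empty")
        case True
        then have "ts ! i = Empty" using A attach_incr_leaves_root by blast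
        then show ?thesis using True by simp
      next
        case False
        then have "root (ds ! i) < a" "decreasing (ds ! i)" using 2(2) d by auto
        moreover have "ts ! i \<noteq> Empty" "root (ts ! i) = root (ds ! i)"
          using A False attach_incr_leaves_root by metis+
        ultimately show ?thesis using A by simp
      qed
    next
      assume "ds ! i = Empty \<and> (\<exists>l>a. ts ! i = Node l (replicate p Empty))"
      then show ?thesis by auto
    qed
  qed
  then have "map (\<lambda>t. if ?c t then MD t else Empty) ts = ds"
      "map (\<lambda>t. if ?c t then skeleton p t else stub p t) ts = ts"
    using len by (intro nth_equalityI; simp only: length_map nth_map)+
  then show ?case by (simp only: MD.simps skeleton.simps)
qed simp

text \<open>Distinctness of the labels excludes an edge between equal labels; such an edge is cut by
  \<open>skeleton\<close> but is not increasing.\<close>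

lemma attach_incr_leaves_MD:
  assumes "pary p T" "distinct (labels T)" "skeleton p T = T"
  shows "attach_incr_leaves p (MD T) T"
  using assms
proof (induction T)
  case Empty
  then show ?case by (simp add: attach_incr_leaves.intros)
next
  case (Node a ts)
  let ?c = "\<lambda>t. t \<noteq> Empty \<and> root t < a"
  have "map (\<lambda>t. if ?c t then skeleton p t else stub p t) ts = map (\<lambda>t. t) ts"
    using Node.prems(3) by simp
  then have fixed: "(if ?c t then skeleton p t else stub p t) = t" if "t \<in> set ts" for t
    using that unfolding map_eq_conv by blast
  have "attach_incr_leaves p (if ?c t then MD t else Empty) t \<or>
      (if ?c t then MD t else Empty) = Empty \<and> (\<exists>l>a. t = Node l (replicate p Empty))"
    if t: "t \<in> set ts" for t
  proof (cases "?c t")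
    case True
    then have "skeleton p t = t" using fixed[OF t] by simp
    moreover have "pary p t" "distinct (labels t)"
      using Node.prems t by (auto simp: distinct_concat_iff)
    ultimately show ?thesis using Node.IH[OF t] True by simp
  next
    case False
    then have st: "stub p t = t" using fixed[OF t] by (simp only: if_False)
    show ?thesis
    proof (cases t)
      case Empty
      then show ?thesis by (simp add: attach_incr_leaves.intros)
    next
      case (Node b us)
      then have "b \<in> set (concat (map labels ts))" using t by force
      then have "b \<noteq> a" using Node.prems(2) by auto
      then show ?thesis using Node st False by auto
    qed
  qed
  then have "list_all2 (\<lambda>d s. attach_incr_leaves p d s \<or>
      d = Empty \<and> (\<exists>l>a. s = Node l (replicate p Empty)))
      (map (\<lambda>t. if ?c t then MD t else Empty) ts) ts"
    unfolding list_all2_conv_all_nth by simp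
  then show ?case unfolding MD.simps by (rule attach_incr_leaves.intros)
qed

lemma pary_MD: "pary p T \<Longrightarrow> pary p (MD T)"
  by (induction T) auto

definition skeletons :: "nat \<Rightarrow> nat \<Rightarrow> nat set \<Rightarrow> nat tree set" where
  "skeletons p k S = {T. pary p T \<and> distinct (labels T) \<and> set (labels T) = S \<and>
     skeleton p T = T \<and> num_vertices (MD T) = k}"

lemma y_count_eq_card_skeletons: "y_count p m k = card (skeletons p k {1..m})"
proof -
  have "(\<exists>D. pary p D \<and> decreasing D \<and> num_vertices D = k \<and> attach_incr_leaves p D T) \<longleftrightarrow>
      skeleton p T = T \<and> num_vertices (MD T) = k" if "T \<in> labeled_trees p m" for T
    using that attach_incr_leaves_imp attach_incr_leaves_MD[of p T] pary_MD[of p T] MD_decreasing[of T]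
    unfolding labeled_trees_def by blast
  then show ?thesis
    unfolding y_count_def skeletons_def labeled_trees_def
    by (intro arg_cong[where f = card]) blast
qed

section \<open>Relabelling\<close>

lemma labels_map_tree: "labels (map_tree f T) = map f (labels T)"
  by (induction T) (auto simp: map_concat cong: map_cong)

lemma set_tree_eq: "set_tree T = set (labels T)"
  by (induction T) auto

lemma pary_map_tree: "pary p (map_tree f T) = pary p T"
  by (induction T) auto

lemma num_vertices_map_tree: "num_vertices (map_tree f T) = num_vertices T"
  by (simp add: num_vertices_def labels_map_tree)

lemma map_tree_eq_Empty [simp]: "map_tree f T = Empty \<longleftrightarrow> T = Empty"
  by (cases T) auto

lemma stub_map_tree: "stub p (map_tree f T) = map_tree f (stub p T)"
  by (cases T) auto

lemma root_map_tree: "T \<noteq> Empty \<Longrightarrow> root (map_tree f T) = f (root T)"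
  by (cases T) auto

text \<open>Order-preserving relabelling changes neither the increasing nor the decreasing edges, so the number
  of skeletons depends only on the size of the label set.\<close>

lemma map_tree_skeleton_MD:
  assumes "strict_mono_on S f" "set (labels T) \<subseteq> S"
  shows "skeleton p (map_tree f T) = map_tree f (skeleton p T) \<and> MD (map_tree f T) = map_tree f (MD T)"
  using assms(2)
proof (induction T)
  case (Node a ts)
  have "(map_tree f t \<noteq> Empty \<and> root (map_tree f t) < f a) \<longleftrightarrow> (t \<noteq> Empty \<and> root t < a)"
    if "t \<in> set ts" for t
  proof (cases "t = Empty")
    case False
    then have "root t \<in> S" "a \<in> S" using Node.prems that root_in_labels[OF False] by auto
    then show ?thesis using False strict_mono_on_less[OF assms(1)] by (simp add: root_map_tree)
  qed simp
  moreover have "skeleton p (map_tree f t) = map_tree f (skeleton p t)"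
      "MD (map_tree f t) = map_tree f (MD t)" if "t \<in> set ts" for t
    using Node.IH[OF that] Node.prems that by auto
  ultimately show ?case by (simp add: stub_map_tree)
qed simp

lemma map_tree_skeletons:
  assumes "strict_mono_on S f" "T \<in> skeletons p k S"
  shows "map_tree f T \<in> skeletons p k (f ` S)"
proof -
  have "inj_on f S" using assms(1) by (rule strict_mono_on_imp_inj_on)
  then show ?thesis
    using assms map_tree_skeleton_MD[OF assms(1), of T p]
    by (simp add: skeletons_def pary_map_tree labels_map_tree distinct_map num_vertices_map_tree)
qed

lemma card_skeletons_lessThan:
  assumes "finite S"
  shows "card (skeletons p k S) = card (skeletons p k {..<card S})"
proof -
  obtain f where f: "bij_betw f {..<card S} S" "strict_mono_on {..<card S} f"
    using ex_bij_betw_strict_mono_card[OF assms] by blast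
  define g where "g = inv_into {..<card S} f"
  have g: "bij_betw g S {..<card S}" unfolding g_def using f(1) by (rule bij_betw_inv_into)
  have gf: "g (f i) = i" if "i \<in> {..<card S}" for i
    unfolding g_def using f(1) that by (rule bij_betw_inv_into_left)
  have fg: "f (g x) = x" if "x \<in> S" for x
    unfolding g_def using f(1) that by (rule bij_betw_inv_into_right)
  have mono_g: "strict_mono_on S g"
  proof (rule strict_mono_onI)
    fix x y assume xy: "x \<in> S" "y \<in> S" "x < y"
    have "g x \<in> {..<card S}" "g y \<in> {..<card S}" using g xy by (auto simp: bij_betw_def)
    then show "g x < g y" using strict_mono_on_less[OF f(2)] fg xy by metis
  qed
  have imf: "f ` {..<card S} = S" and img: "g ` S = {..<card S}"
    using f(1) g by (auto simp: bij_betw_def)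
  have id: "map_tree h (map_tree h' T) = T"
    if "T \<in> skeletons p k U" "\<And>x. x \<in> U \<Longrightarrow> h (h' x) = x" for h h' T U
  proof -
    have "map_tree (h \<circ> h') T = map_tree id T"
      using that by (intro tree.map_cong0) (auto simp: set_tree_eq skeletons_def)
    then show ?thesis by (simp add: tree.map_comp tree.map_id)
  qed
  have "bij_betw (map_tree f) (skeletons p k {..<card S}) (skeletons p k S)"
  proof (intro bij_betw_byWitness[where f' = "map_tree g"])
    show "\<forall>T\<in>skeletons p k {..<card S}. map_tree g (map_tree f T) = T" using id gf by blast
    show "\<forall>T\<in>skeletons p k S. map_tree f (map_tree g T) = T" using id fg by blast
    show "map_tree f ` skeletons p k {..<card S} \<subseteq> skeletons p k S"
      using map_tree_skeletons[OF f(2)] unfolding imf by blast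
    show "map_tree g ` skeletons p k S \<subseteq> skeletons p k {..<card S}"
      using map_tree_skeletons[OF mono_g] unfolding img by blast
  qed
  then show ?thesis by (rule bij_betw_same_card[symmetric])
qed

lemma card_skeletons:
  assumes "finite S"
  shows "card (skeletons p k S) = y_count p (card S) k"
  using card_skeletons_lessThan[OF assms] card_skeletons_lessThan[of "{1..card S}"]
  by (simp add: y_count_eq_card_skeletons)

section \<open>Counting trees by their skeletons\<close>

lemma num_vertices_eq_card: "distinct (labels T) \<Longrightarrow> num_vertices T = card (set (labels T))"
  by (simp add: num_vertices_def distinct_card)

text \<open>Fixing the label set \<open>S\<close> of the skeleton makes the choice of the skeleton and that of the hanging
  forest independent: the forest has \<open>p (card S - k)\<close> positions, whatever the skeleton is.\<close>

lemma bij_betw_skeleton_hanging: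
  assumes "S \<subseteq> V" "finite V"
  shows "bij_betw (\<lambda>T. (skeleton p T, hanging T))
    {T. pary p T \<and> distinct (labels T) \<and> set (labels T) = V \<and> num_vertices (MD T) = k \<and>
        set (labels (skeleton p T)) = S}
    (skeletons p k S \<times> forests p (p * (card S - k)) (V - S))"
    (is "bij_betw ?f ?A (?B \<times> ?C)")
proof (rule bij_betw_imageI)
  show "inj_on ?f ?A"
    by (rule inj_onI) (auto intro: skeleton_hanging_inject)
  have lab: "distinct (labels T) \<longleftrightarrow> distinct (labels (skeleton p T) @ concat (map labels (hanging T)))"
    "set (labels T) = set (labels (skeleton p T) @ concat (map labels (hanging T)))" for T
  proof -
    have *: "mset (labels T) = mset (labels (skeleton p T) @ concat (map labels (hanging T)))"
      using mset_labels_skeleton[of T p] by simp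
    show "distinct (labels T) \<longleftrightarrow> distinct (labels (skeleton p T) @ concat (map labels (hanging T)))"
      using * by (rule mset_eq_imp_distinct_iff)
    show "set (labels T) = set (labels (skeleton p T) @ concat (map labels (hanging T)))"
      using * by (rule mset_eq_setD)
  qed
  show "?f ` ?A = ?B \<times> ?C"
  proof (intro equalityI subsetI)
    fix x assume "x \<in> ?f ` ?A"
    then obtain T where T: "T \<in> ?A" and x: "x = (skeleton p T, hanging T)" by blast
    have d: "distinct (labels (skeleton p T))" "distinct (concat (map labels (hanging T)))"
       "set (labels (skeleton p T)) \<inter> set (concat (map labels (hanging T))) = {}"
      using T lab(1)[of T] unfolding distinct_append by blast+
    have "num_vertices (skeleton p T) = card S"
      using num_vertices_eq_card[OF d(1)] T by simp
    then have "length (hanging T) = p * (card S - k)"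
      using length_hanging[of p T] T by (simp add: diff_mult_distrib2)
    moreover have "set (concat (map labels (hanging T))) = V - S"
      using T lab(2)[of T] d(3) unfolding set_append by blast
    moreover have "\<forall>t\<in>set (hanging T). pary p t" using T pary_hanging by blast
    ultimately have "hanging T \<in> ?C" using d(2) unfolding forests_def by blast
    moreover have "skeleton p T \<in> ?B"
      using T d(1) by (simp add: skeletons_def pary_skeleton skeleton_skeleton MD_skeleton)
    ultimately show "x \<in> ?B \<times> ?C" using x by blast
  next
    fix x assume "x \<in> ?B \<times> ?C"
    then obtain X us where x: "x = (X, us)" and X: "X \<in> ?B" and us: "us \<in> ?C" by blast
    have X': "pary p X" "skeleton p X = X" "distinct (labels X)" "set (labels X) = S"
       "num_vertices (MD X) = k"
      using X by (auto simp: skeletons_def)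
    have us': "length us = p * (card S - k)" "\<forall>u\<in>set us. pary p u"
       "distinct (concat (map labels us))" "set (concat (map labels us)) = V - S"
      using us unfolding forests_def by blast+
    have "length us = length (hanging X)"
      using length_hanging[OF X'(1)] us'(1) X' num_vertices_eq_card[of X] by (simp add: diff_mult_distrib2)
    then obtain T where T: "pary p T" "skeleton p T = X" "hanging T = us"
      using ex_skeleton_hanging[OF X'(1,2) _ us'(2)] by blast
    have "distinct (labels T)"
      unfolding lab(1)[of T] T distinct_append X'(4) us'(4) using X'(3) us'(3) by blast
    moreover have "set (labels T) = V"
      unfolding lab(2)[of T] T set_append X'(4) us'(4) using assms by blast
    moreover have "num_vertices (MD T) = k" using X'(5) T(2) MD_skeleton[of p T] by simp
    ultimately have "T \<in> ?A" using T X' by simp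
    then show "x \<in> ?f ` ?A" using T x by blast
  qed
qed

lemma singleton_in_forests: "[T] \<in> forests p 1 {1..n} \<longleftrightarrow> T \<in> labeled_trees p n"
  unfolding labeled_trees_def forests_def by simp

lemma finite_labeled_trees: "finite (labeled_trees p n)"
proof (rule inj_on_finite)
  show "inj_on (\<lambda>T. [T]) (labeled_trees p n)" by (rule inj_onI) simp
  show "(\<lambda>T. [T]) ` labeled_trees p n \<subseteq> forests p 1 {1..n}"
    using singleton_in_forests by blast
  show "finite (forests p 1 {1..n})"
    by (rule card_forests[THEN conjunct1]) simp
qed

lemma sum_Pow_card:
  fixes g :: "nat \<Rightarrow> real"
  assumes "finite V"
  shows "(\<Sum>S\<in>Pow V. g (card S)) = (\<Sum>m\<le>card V. real (card V choose m) * g m)"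
proof -
  have "(\<Sum>S\<in>Pow V. g (card S)) = (\<Sum>m\<le>card V. \<Sum>S\<in>{S \<in> Pow V. card S = m}. g (card S))"
    using assms by (intro sum.group[symmetric]) (auto intro: card_mono)
  also have "\<dots> = (\<Sum>m\<le>card V. real (card V choose m) * g m)"
  proof (rule sum.cong[OF refl])
    fix m
    have "(\<Sum>S\<in>{S \<in> Pow V. card S = m}. g (card S)) = (\<Sum>S\<in>{S. S \<subseteq> V \<and> card S = m}. g m)"
      by (rule sum.cong) auto
    then show "(\<Sum>S\<in>{S \<in> Pow V. card S = m}. g (card S)) = real (card V choose m) * g m"
      by (simp add: n_subsets[OF assms])
  qed
  finally show ?thesis .
qed

lemma t_count_eq_sum:
  "real (t_count p n k) =
     (\<Sum>m\<le>n. real (n choose m) * (real (y_count p m k) * forest_number p (p * (m - k)) (n - m)))"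
proof -
  let ?A = "{T \<in> labeled_trees p n. num_vertices (MD T) = k}"
  let ?AS = "\<lambda>S. {T \<in> ?A. set (labels (skeleton p T)) = S}"
  have fin: "finite ?A" using finite_labeled_trees by simp
  have AS: "real (card (?AS S)) =
      real (y_count p (card S) k) * forest_number p (p * (card S - k)) (n - card S)"
    if S: "S \<subseteq> {1..n}" for S
  proof -
    have "finite S" using finite_subset[OF S] by simp
    have "?AS S = {T. pary p T \<and> distinct (labels T) \<and> set (labels T) = {1..n} \<and>
        num_vertices (MD T) = k \<and> set (labels (skeleton p T)) = S}"
      by (auto simp: labeled_trees_def)
    then have "card (?AS S) = card (skeletons p k S \<times> forests p (p * (card S - k)) ({1..n} - S))"
      using bij_betw_same_card[OF bij_betw_skeleton_hanging[OF S, of p k]] by simp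
    moreover have "card ({1..n} - S) = n - card S"
      using card_Diff_subset[OF \<open>finite S\<close> S] by simp
    ultimately show ?thesis
      using card_forests[of "{1..n} - S" p "p * (card S - k)"]
      by (simp add: card_cartesian_product card_skeletons[OF \<open>finite S\<close>])
  qed
  have sub: "set (labels (skeleton p T)) \<subseteq> {1..n}" if "T \<in> ?A" for T
  proof -
    have "set_mset (mset (labels (skeleton p T))) \<subseteq> set_mset (mset (labels T))"
      unfolding mset_labels_skeleton[of T p] by simp
    then show ?thesis using that by (simp add: labeled_trees_def)
  qed
  have "(\<Sum>S\<in>Pow {1..n}. \<Sum>T\<in>?AS S. 1) = (\<Sum>T\<in>?A. 1::real)"
  proof (rule sum.group[OF fin])
    show "(\<lambda>T. set (labels (skeleton p T))) ` ?A \<subseteq> Pow {1..n}" using sub by blast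
  qed simp
  then have "real (t_count p n k) = (\<Sum>S\<in>Pow {1..n}. real (card (?AS S)))"
    by (simp add: t_count_def)
  also have "\<dots> = (\<Sum>S\<in>Pow {1..n}. real (y_count p (card S) k) *
      forest_number p (p * (card S - k)) (n - card S))"
    by (rule sum.cong[OF refl AS]) blast
  also have "\<dots> = (\<Sum>m\<le>n. real (n choose m) *
      (real (y_count p m k) * forest_number p (p * (m - k)) (n - m)))"
    using sum_Pow_card[of "{1..n}"
        "\<lambda>m. real (y_count p m k) * forest_number p (p * (m - k)) (n - m)"] by simp
  finally show ?thesis .
qed

section \<open>Decreasing trees\<close>

lemma sum_list_eq_imp_pointwise:
  fixes f g :: "'a \<Rightarrow> nat"
  assumes "\<And>x. x \<in> set xs \<Longrightarrow> f x \<le> g x" "sum_list (map f xs) = sum_list (map g xs)" "x \<in> set xs"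
  shows "f x = g x"
  using assms
proof (induction xs)
  case (Cons y ys)
  have "sum_list (map f ys) \<le> sum_list (map g ys)"
    using Cons.prems(1) by (intro sum_list_mono) simp
  moreover have "f y \<le> g y" using Cons.prems(1) by simp
  ultimately have "f y = g y" "sum_list (map f ys) = sum_list (map g ys)"
    using Cons.prems(2) by simp_all
  then show ?case using Cons.IH Cons.prems(1,3) by auto
qed simp

lemma num_vertices_MD:
  "num_vertices (MD T) \<le> num_vertices T \<and> (num_vertices (MD T) = num_vertices T \<longrightarrow> decreasing T)"
proof (induction T)
  case (Node a ts)
  let ?c = "\<lambda>t. t \<noteq> Empty \<and> root t < a"
  let ?f = "\<lambda>t. num_vertices (if ?c t then MD t else Empty)"
  have le: "?f t \<le> num_vertices t" if "t \<in> set ts" for t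
    using Node.IH[OF that] by simp
  have MD: "num_vertices (MD (Node a ts)) = Suc (sum_list (map ?f ts))"
    by (simp add: comp_def)
  have "sum_list (map ?f ts) \<le> sum_list (map num_vertices ts)"
    using le by (rule sum_list_mono)
  moreover have "decreasing (Node a ts)"
    if eq: "num_vertices (MD (Node a ts)) = num_vertices (Node a ts)"
  proof -
    have "(t \<noteq> Empty \<longrightarrow> root t < a) \<and> decreasing t" if t: "t \<in> set ts" for t
    proof -
      have "sum_list (map ?f ts) = sum_list (map num_vertices ts)"
        using eq unfolding MD by simp
      then have "?f t = num_vertices t"
        using sum_list_eq_imp_pointwise[of ts ?f num_vertices t] le t by blast
      then show ?thesis using Node.IH[OF t] by (cases t rule: tree.exhaust) (auto split: if_splits)
    qed
    then show ?thesis by simp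
  qed
  ultimately show ?case unfolding MD by simp
qed simp

lemma MD_eq_self: "decreasing T \<Longrightarrow> MD T = T"
  by (induction T) (auto intro!: map_idI)

lemma t_count_self:
  assumes "p > 0"
  shows "t_count p n n = (\<Prod>j<n. 1 + j * (p - 1))"
proof -
  have "num_vertices (MD T) = n \<longleftrightarrow> decreasing T" if "T \<in> labeled_trees p n" for T
  proof -
    have "num_vertices T = n"
      using that num_vertices_eq_card[of T] by (simp add: labeled_trees_def)
    then show ?thesis using num_vertices_MD[of T] MD_eq_self[of T] by metis
  qed
  then have t: "t_count p n n = card {T \<in> labeled_trees p n. decreasing T}"
    unfolding t_count_def by (intro arg_cong[where f = card]) blast
  let ?D = "{T \<in> labeled_trees p n. decreasing T}"
  have "bij_betw (\<lambda>T. [T]) ?D (decreasing_forests p 1 {1..n})"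
  proof (rule bij_betw_imageI)
    show "inj_on (\<lambda>T. [T]) ?D" by (rule inj_onI) simp
    have single: "[T] \<in> decreasing_forests p 1 {1..n} \<longleftrightarrow> T \<in> ?D" for T
      using singleton_in_forests[of T p n] by (simp add: decreasing_forests_def)
    show "(\<lambda>T. [T]) ` ?D = decreasing_forests p 1 {1..n}"
    proof (intro equalityI subsetI)
      fix ts assume ts: "ts \<in> decreasing_forests p 1 {1..n}"
      then have "length ts = 1" unfolding decreasing_forests_def forests_def by blast
      then obtain T where "ts = [T]" by (metis One_nat_def length_0_conv length_Suc_conv)
      then show "ts \<in> (\<lambda>T. [T]) ` ?D" using ts single by blast
    qed (use single in blast)
  qed
  then have "card ?D = card (decreasing_forests p 1 {1..n})"
    by (rule bij_betw_same_card)
  then show ?thesis using card_decreasing_forests[of "{1..n}" p 1] assms unfolding t by simp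
qed

section \<open>The two formulas\<close>

text \<open>This lets the sum over all sizes of the skeleton start at \<open>k\<close>.\<close>

lemma y_count_eq_0:
  assumes "m < k"
  shows "y_count p m k = 0"
proof -
  have "num_vertices (MD T) \<noteq> k" if "distinct (labels T)" "set (labels T) = {1..m}" for T
    using num_vertices_MD[of T] num_vertices_eq_card[OF that(1)] that(2) assms by simp
  then have "skeletons p k {1..m} = {}" unfolding skeletons_def by blast
  then show ?thesis by (simp add: y_count_eq_card_skeletons)
qed

theorem theorem3:
  fixes p :: nat
  assumes "p \<ge> 2"
  shows "(\<forall>n k :: nat. 1 \<le> k \<and> k < n \<longrightarrow>
            real (t_count p n k) =
              (\<Sum>m = k..n. real (n choose m) * ((real m - real k) / (real n - real k))
                 * falling_factorial (real p * real n - real p * real k) (n - m)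
                 * real (y_count p m k)))
       \<and> (\<forall>n::nat. 1 \<le> n \<longrightarrow>
            int (t_count p n n) = (\<Prod>j = 0..n - 1. int p * int j - int j + 1))"
proof (intro conjI allI impI)
  fix n k :: nat
  assume "1 \<le> k \<and> k < n"
  then have "k < n" by simp
  have "real (t_count p n k) = (\<Sum>m = k..n. real (n choose m) *
      (real (y_count p m k) * forest_number p (p * (m - k)) (n - m)))"
    unfolding t_count_eq_sum
    by (rule sum.mono_neutral_right) (auto simp: y_count_eq_0)
  also have "\<dots> = (\<Sum>m = k..n. real (n choose m) * ((real m - real k) / (real n - real k))
                 * falling_factorial (real p * real n - real p * real k) (n - m)
                 * real (y_count p m k))"
    using \<open>k < n\<close> assms by (intro sum.cong) (simp_all add: forest_number_rooted)
  finally show "real (t_count p n k) = (\<Sum>m = k..n. real (n choose m) * ((real m - real k) / (real n - real k))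
                 * falling_factorial (real p * real n - real p * real k) (n - m)
                 * real (y_count p m k))" .
next
  fix n :: nat
  assume "1 \<le> n"
  then have "{0..n - 1} = {..<n}" by (cases n) (simp_all add: atLeast0AtMost lessThan_Suc_atMost)
  moreover have "int (1 + j * (p - 1)) = int p * int j - int j + 1" for j
    using assms by (simp add: of_nat_diff algebra_simps)
  moreover have "t_count p n n = (\<Prod>j<n. 1 + j * (p - 1))"
    using assms by (intro t_count_self) simp
  ultimately show "int (t_count p n n) = (\<Prod>j = 0..n - 1. int p * int j - int j + 1)"
    by (simp only: of_nat_prod)
qed

end
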